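(* Every Stäckel-compact space $X$ is countably compact.
   Context: Work in ZFC. A Hausdorff topological space $X$ is Stäckel-compact if there is a linear (total) order $\prec$ on the set $X$ such that every non-empty closed subset of $X$ has a $\prec$-least and a $\prec$-greatest element; $\prec$ is not assumed to be related to the topology of $X$ in any other way. In particular, Stäckel-compact spaces are Hausdorff by definition. *)

theory Defs
  imports "HOL-Analysis.Analysis"
begin

text \<open>The order is the reflexive (non-strict) version of the order in the literature, is an order on
  the points of the space only, and need not be compatible with the topology.\<close>

definition Staeckel_compact_space :: "'a topology \<Rightarrow> bool" where
  "Staeckel_compact_space X \<longleftrightarrow>
     Hausdorff_space X \<and>
     (\<exists>r. linear_order_on (topspace X) r \<and>
          (\<forall>C. closedin X C \<and> C \<noteq> {} \<longrightarrow>
               (\<exists>a\<in>C. \<forall>x\<in>C. (a, x) \<in> r) \<and> (\<exists>b\<in>C. \<forall>x\<in>C. (x, b) \<in> r)))"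

text \<open>The library's \<^const>\<open>countably_compact\<close> only concerns subsets of types of class
  \<^class>\<open>topological_space\<close>; this is the counterpart for arbitrary (possibly empty) spaces,
  analogous to \<^const>\<open>compact_space\<close>.\<close>

definition countably_compact_space :: "'a topology \<Rightarrow> bool" where
  "countably_compact_space X \<longleftrightarrow>
     (\<forall>\<U>. countable \<U> \<and> (\<forall>U\<in>\<U>. openin X U) \<and> topspace X \<subseteq> \<Union>\<U>
        \<longrightarrow> (\<exists>\<F>. finite \<F> \<and> \<F> \<subseteq> \<U> \<and> topspace X \<subseteq> \<Union>\<F>))"

lemma countably_compact_space_euclidean:
  "countably_compact_space (euclidean :: 'a::topological_space topology)
     \<longleftrightarrow> countably_compact (UNIV :: 'a set)"
  unfolding countably_compact_space_def countably_compact_def by (simp, meson)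

end

theory Submission
  imports Defs
begin

text \<open>
  If a \<open>T\<^sub>1\<close> space is not countably compact, then it has an infinite subset \<open>D\<close> all of whose subsets are
  closed (lemma \<open>infinite_all_subsets_closed_if_not_countably_compact\<close>). In a Staeckel-compact space,
  every non-empty subset of \<open>D\<close> would thus have both a least and a greatest element, so that \<open>D\<close> would
  be well-ordered by the order and by its converse. Only finite sets admit such an order (lemma
  \<open>finite_if_all_subsets_have_least_and_greatest\<close>), a contradiction.
\<close>

text \<open>
  Let \<open>A\<close> consist of the elements of \<open>D\<close> with finitely many predecessors. It is finite, having a greatest
  element if it is non-empty. The least element outside \<open>A\<close> would have its predecessors in \<open>A\<close> apart
  from itself, so that it would belong to \<open>A\<close>. Hence \<open>A = D\<close>.
\<close>

lemma finite_if_all_subsets_have_least_and_greatest: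
  assumes "antisym r"
    and least: "\<And>S. S \<subseteq> D \<Longrightarrow> S \<noteq> {} \<Longrightarrow> \<exists>a\<in>S. \<forall>x\<in>S. (a, x) \<in> r"
    and greatest: "\<And>S. S \<subseteq> D \<Longrightarrow> S \<noteq> {} \<Longrightarrow> \<exists>b\<in>S. \<forall>x\<in>S. (x, b) \<in> r"
  shows "finite D"
proof -
  define A where "A = {a \<in> D. finite {x \<in> D. (x, a) \<in> r}}"
  have "A \<subseteq> D"
    by (auto simp: A_def)
  have "A = D"
  proof (rule ccontr)
    assume "A \<noteq> D"
    then obtain m where m: "m \<in> D - A" and m_least: "\<And>x. x \<in> D - A \<Longrightarrow> (m, x) \<in> r"
      using least[of "D - A"] \<open>A \<subseteq> D\<close> by blast
    have below: "{x \<in> D. (x, m) \<in> r} \<subseteq> insert m A"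
      using m_least \<open>antisym r\<close> by (auto dest: antisymD)
    have "finite A"
    proof (cases "A = {}")
      case False
      then obtain b where "b \<in> A" and "\<And>x. x \<in> A \<Longrightarrow> (x, b) \<in> r"
        using greatest[of A] \<open>A \<subseteq> D\<close> by blast
      then have "A \<subseteq> {x \<in> D. (x, b) \<in> r}" "finite {x \<in> D. (x, b) \<in> r}"
        by (auto simp: A_def)
      then show ?thesis
        by (rule finite_subset)
    qed simp
    then have "finite {x \<in> D. (x, m) \<in> r}"
      using finite_subset[OF below] by simp
    then show False
      using m by (simp add: A_def)
  qed
  show "finite D"
  proof (cases "D = {}")
    case False
    then obtain b where "b \<in> D" and "\<And>x. x \<in> D \<Longrightarrow> (x, b) \<in> r"
      using greatest[of D] by blast
    then have "{x \<in> D. (x, b) \<in> r} = D"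
      by blast
    then show ?thesis
      using \<open>b \<in> D\<close> \<open>A = D\<close> by (metis (no_types, lifting) A_def mem_Collect_eq)
  qed simp
qed

text \<open>
  Given a countable open cover \<open>U 0, U 1, \<dots>\<close> without a finite subcover, pick points \<open>x n\<close> outside
  \<open>U 0 \<union> \<dots> \<union> U n\<close>. For each \<open>n\<close>, only the indices \<open>i < n\<close> can satisfy \<open>x i \<in> U n\<close>. Hence every
  value is attained finitely often, so the set \<open>D\<close> of all \<open>x n\<close> is infinite; and \<open>D\<close> has no accumulation
  point because every \<open>U n\<close> meets it in a finite set, which is closed by \<open>T\<^sub>1\<close>.
\<close>

lemma infinite_all_subsets_closed_if_not_countably_compact:
  assumes "t1_space X" and "\<not> countably_compact_space X"
  obtains D where "infinite D" and "\<And>S. S \<subseteq> D \<Longrightarrow> closedin X S"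
proof -
  obtain \<U> where "countable \<U>" and op: "\<forall>V\<in>\<U>. openin X V" and cover: "topspace X \<subseteq> \<Union>\<U>"
    and "\<nexists>\<F>. finite \<F> \<and> \<F> \<subseteq> \<U> \<and> topspace X \<subseteq> \<Union>\<F>"
    using assms(2) unfolding countably_compact_space_def by (simp only: not_all not_imp) (elim exE conjE)
  then have no_fin: "\<not> topspace X \<subseteq> \<Union>\<F>" if "finite \<F>" "\<F> \<subseteq> \<U>" for \<F>
    using that by blast
  have "\<U> \<noteq> {}"
    using no_fin[of "{}"] cover by auto
  define U where "U = from_nat_into \<U>"
  have range_U: "range U = \<U>"
    unfolding U_def using \<open>countable \<U>\<close> \<open>\<U> \<noteq> {}\<close> by (rule range_from_nat_into[rotated])
  have "\<exists>x. x \<in> topspace X \<and> (\<forall>i\<le>n. x \<notin> U i)" for n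
  proof -
    have "\<not> topspace X \<subseteq> \<Union>(U ` {..n})"
      using range_U by (intro no_fin) auto
    then show ?thesis
      by blast
  qed
  then obtain x where x_in: "\<And>n. x n \<in> topspace X" and x_out: "\<And>n i. i \<le> n \<Longrightarrow> x n \<notin> U i"
    by metis
  have before: "i < n" if "x i \<in> U n" for i n
    using x_out[of n i] that by (cases "n \<le> i") auto
  have fin: "finite (range x \<inter> U n)" for n
  proof (rule finite_subset)
    show "range x \<inter> U n \<subseteq> x ` {..<n}"
      using before by auto
  qed simp
  show thesis
  proof (rule that)
    show "infinite (range x)"
    proof
      assume "finite (range x)"
      \<comment> \<open>Some value is then attained infinitely often, although it lies in some \<open>U n\<close>.\<close>
      then obtain k where inf: "infinite {i. x i = x k}"
        using pigeonhole_infinite[of UNIV x] by auto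
      obtain n where "x k \<in> U n"
        using x_in[of k] cover range_U by blast
      then have "{i. x i = x k} \<subseteq> {..<n}"
        using before by (metis (mono_tags, lifting) lessThan_iff mem_Collect_eq subsetI)
      then show False
        using inf finite_subset by blast
    qed
  next
    fix S assume S: "S \<subseteq> range x"
    have "openin X (topspace X - S)"
    proof (subst openin_subopen, intro ballI)
      fix y assume y: "y \<in> topspace X - S"
      then obtain n where n: "y \<in> U n"
        using cover range_U by blast
      have "finite (S \<inter> U n)"
        using fin[of n] S by (meson Int_mono finite_subset order_refl)
      moreover have "S \<inter> U n \<subseteq> topspace X"
        using S x_in by auto
      ultimately have "closedin X (S \<inter> U n)"
        using \<open>t1_space X\<close> by (simp add: t1_space_closedin_finite)
      moreover have "openin X (U n)"
        using op range_U by blast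
      ultimately have "openin X (U n - S \<inter> U n)"
        by (rule openin_diff[rotated])
      moreover have "U n - S \<inter> U n \<subseteq> topspace X - S"
        using openin_subset[OF \<open>openin X (U n)\<close>] by blast
      ultimately show "\<exists>T. openin X T \<and> y \<in> T \<and> T \<subseteq> topspace X - S"
        using n y by blast
    qed
    then show "closedin X S"
      using S x_in by (auto simp: closedin_def)
  qed
qed

theorem proposition3p3:
  fixes X :: "'a topology"
  assumes "Staeckel_compact_space X"
  shows "countably_compact_space X"
proof (rule ccontr)
  assume not_cc: "\<not> countably_compact_space X"
  obtain r where "Hausdorff_space X" and r: "linear_order_on (topspace X) r"
    and extrema: "\<And>C. closedin X C \<Longrightarrow> C \<noteq> {} \<Longrightarrow>
      (\<exists>a\<in>C. \<forall>x\<in>C. (a, x) \<in> r) \<and> (\<exists>b\<in>C. \<forall>x\<in>C. (x, b) \<in> r)"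
    using assms unfolding Staeckel_compact_space_def by blast
  have "t1_space X"
    using \<open>Hausdorff_space X\<close> by (rule Hausdorff_imp_t1_space)
  then obtain D where "infinite D" and closed: "\<And>S. S \<subseteq> D \<Longrightarrow> closedin X S"
    using infinite_all_subsets_closed_if_not_countably_compact not_cc by blast
  have "antisym r"
    using r by (simp add: order_on_defs)
  then have "finite D"
    by (rule finite_if_all_subsets_have_least_and_greatest) (use extrema closed in blast)+
  with \<open>infinite D\<close> show False
    by contradiction
qed

end
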